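(* Let $m,n\in\mathbb{N}$ and let $a,b$ be integers with $1\le a\le n$ and $1\le b\le m$. Let $\mathcal{Z}=R_{a,b}$. Then $$\gamma(\mathcal{Z},m,n)=\min_{\substack{b\le x\le m\\ a\le y\le n}}\bigl((m-x)(n-y)+\max(ax,by)\bigr),$$ where $x,y$ range over integers, and this quantity can be computed in time $\mathcal{O}(\min(a,b)/\gcd(a,b))$. In particular, for $a=b$ and $m=n$, $$\gamma(\mathcal{Z},n,n)=\begin{cases} an-a^2/4, & \text{if } a\le 2n/3 \text{ and } a \text{ is even},\\ an-(a^2-1)/4, & \text{if } a\le (2n+1)/3 \text{ and } a \text{ is odd},\\ a^2+(n-a)^2, & \text{otherwise}.\end{cases}$$
   Context: $\mathbb{Z}_+=\{0,1,2,\dots\}$, $\mathbb{N}=\{1,2,\dots\}$, $[0,c]=\{0,1,\dots,c\}$, and $R_{a,b}=[0,a-1]\times[0,b-1]$. A zero-set (Young diagram) is a downward-closed set $\mathcal{Z}\subseteq\mathbb{Z}_+^2$; $\emptyset$ and infinite sets are allowed. For $m,n\in\mathbb{N}$, the graph $K_m\Box K_n$ is represented on the vertex set $R_{n,m}=[0,n-1]\times[0,m-1]$, with two vertices adjacent iff they differ in exactly one coordinate. For $v=(j,i)\in R_{n,m}$, the row neighborhood $\mathcal{N}^r(v)$ is the set of all $(j',i)\in R_{n,m}$ with $j'\neq j$, and the column neighborhood $\mathcal{N}^c(v)$ is the set of all $(j,i')\in R_{n,m}$ with $i'\ne i$. Given $\mathcal{Z}$, for $A\subseteq R_{n,m}$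 let $\mathcal{T}(A)=A\cup\{v\in R_{n,m}\setminus A\colon (|\mathcal{N}^r(v)\cap A|,|\mathcal{N}^c(v)\cap A|)\notin\mathcal{Z}\}$. Then $\gamma(\mathcal{Z},m,n)=\min\{|A|\colon A\subseteq R_{n,m},\ \mathcal{T}(A)=R_{n,m}\}$. The running time is that of an algorithm with input integers $a,b,m,n$, counted in elementary arithmetic operations and comparisons on integers (unit cost). *)

theory Defs
  imports Complex_Main
begin

definition rect :: "nat \<Rightarrow> nat \<Rightarrow> (nat \<times> nat) set" where
  "rect a b = {0..<a} \<times> {0..<b}"

definition zero_set :: "(nat \<times> nat) set \<Rightarrow> bool" where
  "zero_set Z \<longleftrightarrow> (\<forall>u v u' v'. (u, v) \<in> Z \<longrightarrow> u' \<le> u \<longrightarrow> v' \<le> v \<longrightarrow> (u', v') \<in> Z)"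

lemma zero_set_rect: "zero_set (rect a b)"
  by (auto simp: zero_set_def rect_def)

(* The Cartesian product of K_m and K_n has vertex set rect n m; a vertex is a pair
   (column, row) = (j, i) with j < n and i < m. *)

definition row_nbhd :: "nat \<Rightarrow> nat \<Rightarrow> nat \<times> nat \<Rightarrow> (nat \<times> nat) set" where
  "row_nbhd m n v = {w \<in> rect n m. snd w = snd v \<and> fst w \<noteq> fst v}"

definition col_nbhd :: "nat \<Rightarrow> nat \<Rightarrow> nat \<times> nat \<Rightarrow> (nat \<times> nat) set" where
  "col_nbhd m n v = {w \<in> rect n m. fst w = fst v \<and> snd w \<noteq> snd v}"

definition growth :: "(nat \<times> nat) set \<Rightarrow> nat \<Rightarrow> nat \<Rightarrow> (nat \<times> nat) set \<Rightarrow> (nat \<times> nat) set" where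
  "growth Z m n A =
     A \<union> {v \<in> rect n m - A. (card (row_nbhd m n v \<inter> A), card (col_nbhd m n v \<inter> A)) \<notin> Z}"

definition gamma :: "(nat \<times> nat) set \<Rightarrow> nat \<Rightarrow> nat \<Rightarrow> nat" where
  "gamma Z m n = Min {card A | A. A \<subseteq> rect n m \<and> growth Z m n A = rect n m}"

(* Algorithms are while-programs over integer registers.  The unit-cost measure counts
   every evaluated arithmetic operation and comparison; reading or writing a register,
   literals, Boolean connectives and control transfer are free.  Each loop iteration
   evaluates a guard, hence at least one comparison, so these free steps only affect
   constant factors.  Division is integer (floor) division, with x div 0 = 0. *)

type_synonym state = "nat \<Rightarrow> int"

datatype aexp = Lit int | Reg nat | Add aexp aexp | Sub aexp aexp | Mul aexp aexp | Div aexp aexp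

datatype bexp = Lt aexp aexp | Eql aexp aexp | Neg bexp | Conj bexp bexp

datatype prog = Skip | Assign nat aexp | Seq prog prog | Cond bexp prog prog | While bexp prog

fun aval :: "aexp \<Rightarrow> state \<Rightarrow> int" where
  "aval (Lit k) s = k"
| "aval (Reg r) s = s r"
| "aval (Add e f) s = aval e s + aval f s"
| "aval (Sub e f) s = aval e s - aval f s"
| "aval (Mul e f) s = aval e s * aval f s"
| "aval (Div e f) s = aval e s div aval f s"

fun acost :: "aexp \<Rightarrow> nat" where
  "acost (Lit k) = 0"
| "acost (Reg r) = 0"
| "acost (Add e f) = acost e + acost f + 1"
| "acost (Sub e f) = acost e + acost f + 1"
| "acost (Mul e f) = acost e + acost f + 1"
| "acost (Div e f) = acost e + acost f + 1"

fun bval :: "bexp \<Rightarrow> state \<Rightarrow> bool" where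
  "bval (Lt e f) s \<longleftrightarrow> aval e s < aval f s"
| "bval (Eql e f) s \<longleftrightarrow> aval e s = aval f s"
| "bval (Neg g) s \<longleftrightarrow> \<not> bval g s"
| "bval (Conj g h) s \<longleftrightarrow> bval g s \<and> bval h s"

fun bcost :: "bexp \<Rightarrow> nat" where
  "bcost (Lt e f) = acost e + acost f + 1"
| "bcost (Eql e f) = acost e + acost f + 1"
| "bcost (Neg g) = bcost g"
| "bcost (Conj g h) = bcost g + bcost h"

(* runs p s t s': started in s, the program p halts in s' after t counted operations *)
inductive runs :: "prog \<Rightarrow> state \<Rightarrow> nat \<Rightarrow> state \<Rightarrow> bool" where
  Skip: "runs Skip s 0 s"
| Assign: "runs (Assign r e) s (acost e) (s(r := aval e s))"
| Seq: "runs p s t s' \<Longrightarrow> runs q s' t' s'' \<Longrightarrow> runs (Seq p q) s (t + t') s''"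
| CondTrue: "bval g s \<Longrightarrow> runs p s t s' \<Longrightarrow> runs (Cond g p q) s (bcost g + t) s'"
| CondFalse: "\<not> bval g s \<Longrightarrow> runs q s t s' \<Longrightarrow> runs (Cond g p q) s (bcost g + t) s'"
| WhileFalse: "\<not> bval g s \<Longrightarrow> runs (While g p) s (bcost g) s"
| WhileTrue: "bval g s \<Longrightarrow> runs p s t s' \<Longrightarrow> runs (While g p) s' t' s'' \<Longrightarrow>
    runs (While g p) s (bcost g + t + t') s''"

definition init_state :: "nat \<Rightarrow> nat \<Rightarrow> nat \<Rightarrow> nat \<Rightarrow> state" where
  "init_state a b m n = (\<lambda>_. 0)(0 := int a, 1 := int b, 2 := int m, 3 := int n)"

definition out_val :: "state \<Rightarrow> int" where
  "out_val s = s 0"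

end

theory Submission
  imports Defs "HOL-Number_Theory.Cong"
begin

text \<open>
  Let \<open>X\<close> be the rows with at least \<open>a\<close> points of \<open>A\<close>, \<open>Y\<close> the columns with at least \<open>b\<close> points,
  \<open>x = |X|\<close> and \<open>y = |Y|\<close>. Then \<open>A\<close> spans in one step iff it contains all cells outside these
  rows and columns, whence \<open>|A| \<ge> (m - x) (n - y) + max (a x) (b y)\<close>. If \<open>x < b\<close> or \<open>y < a\<close>, pushing
  \<open>x\<close> up to \<open>b\<close> or \<open>y\<close> up to \<open>a\<close> does not increase this bound, except that when both are small
  one needs \<open>a x + b y - x y\<close> in place of the maximum. Conversely, a balanced
  filling of an \<open>x \<times> y\<close> corner together with the full opposite block attains the bound.

  For the algorithm let \<open>b \<le> a\<close>. For fixed \<open>x\<close>, the cost is monotone or linear in \<open>y\<close> on either side of the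
  diagonal \<open>a x = b y\<close>, so that only \<open>y = n\<close> and the two integers \<open>y\<close> next to \<open>a x / b\<close> matter. As
  \<open>x\<close> runs through a residue class modulo \<open>b / gcd a b\<close>, these points lie on two rays
  parallel to the diagonal, on which the cost is a convex quadratic, minimized in constant time.
  The modulus itself is found as the least \<open>k > 0\<close> with \<open>b dvd a k\<close>, avoiding Euclid's algorithm.
\<close>

subsection \<open>The minimal size of a spanning set\<close>

text \<open>The counts run over the whole row and column of \<open>(j, i)\<close>; as this cell is
  not in \<open>A\<close>, they agree with the counts over its neighborhoods. A pair of counts is
  outside \<open>rect a b\<close> iff the first is at least \<open>a\<close> or the second at least
  \<open>b\<close>.\<close>

definition spanning :: "nat \<Rightarrow> nat \<Rightarrow> nat \<Rightarrow> nat \<Rightarrow> (nat \<times> nat) set \<Rightarrow> bool" where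
  "spanning a b m n A \<longleftrightarrow> A \<subseteq> rect n m \<and>
     (\<forall>j<n. \<forall>i<m. (j, i) \<notin> A \<longrightarrow> a \<le> card (A\<inverse> `` {i}) \<or> b \<le> card (A `` {j}))"

lemma finite_rect [simp]: "finite (rect n m)"
  by (simp add: rect_def)

lemma card_row_nbhd_Int:
  assumes "A \<subseteq> rect n m" "(j, i) \<notin> A"
  shows "card (row_nbhd m n (j, i) \<inter> A) = card (A\<inverse> `` {i})"
proof -
  have "row_nbhd m n (j, i) \<inter> A = (\<lambda>j. (j, i)) ` (A\<inverse> `` {i})"
    using assms by (auto simp: row_nbhd_def image_iff)
  then show ?thesis
    by (simp add: card_image inj_on_def)
qed

lemma card_col_nbhd_Int:
  assumes "A \<subseteq> rect n m" "(j, i) \<notin> A"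
  shows "card (col_nbhd m n (j, i) \<inter> A) = card (A `` {j})"
proof -
  have "col_nbhd m n (j, i) \<inter> A = Pair j ` (A `` {j})"
    using assms by (auto simp: col_nbhd_def image_iff)
  then show ?thesis
    by (simp add: card_image inj_on_def)
qed

lemma growth_eq_rect_iff:
  assumes "A \<subseteq> rect n m"
  shows "growth (rect a b) m n A = rect n m \<longleftrightarrow> spanning a b m n A"
proof -
  have "growth (rect a b) m n A = rect n m \<longleftrightarrow>
      (\<forall>j<n. \<forall>i<m. (j, i) \<notin> A \<longrightarrow> (j, i) \<in> growth (rect a b) m n A)"
    using assms by (auto simp: growth_def rect_def)
  also have "\<dots> \<longleftrightarrow> (\<forall>j<n. \<forall>i<m. (j, i) \<notin> A \<longrightarrow>
      a \<le> card (A\<inverse> `` {i}) \<or> b \<le> card (A `` {j}))"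
    using card_row_nbhd_Int[OF assms] card_col_nbhd_Int[OF assms]
    by (simp add: growth_def rect_def not_less de_Morgan_conj)
  finally show ?thesis
    using assms by (simp add: spanning_def)
qed

lemma spanning_converse: "spanning a b m n A \<Longrightarrow> spanning b a n m (A\<inverse>)"
  by (auto simp: spanning_def rect_def)

section \<open>Lower bound by counting in heavy rows and columns\<close>

lemma card_Times_fibres_ge:
  fixes A :: "('a \<times> 'b) set"
  assumes "finite A" "finite Y" "\<And>j. j \<in> Y \<Longrightarrow> b \<le> card (A `` {j})"
  shows "b * card Y \<le> card (A \<inter> Y \<times> UNIV)"
proof -
  have "A \<inter> Y \<times> UNIV = (SIGMA j:Y. A `` {j})"
    by auto
  moreover have "\<forall>j\<in>Y. finite (A `` {j})"
    using assms(1) by (simp add: finite_Image)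
  ultimately have "card (A \<inter> Y \<times> UNIV) = (\<Sum>j\<in>Y. card (A `` {j}))"
    using assms(2) card_SigmaI by metis
  then show ?thesis
    using sum_bounded_below[of Y b "\<lambda>j. card (A `` {j})"] assms(3)
    by (simp add: mult.commute)
qed

definition cost :: "int \<Rightarrow> int \<Rightarrow> int \<Rightarrow> int \<Rightarrow> int \<Rightarrow> int \<Rightarrow> int" where
  "cost a b m n x y = (m - x) * (n - y) + max (a * x) (b * y)"

lemma cost_swap: "cost b a n m y x = cost a b m n x y"
  by (simp add: cost_def mult.commute max.commute)

text \<open>The block \<open>B\<close> outside the heavy rows \<open>X\<close> and the heavy columns
  \<open>Y\<close> lies in \<open>A\<close>. The other points of \<open>A\<close> form
  \<open>R \<union> S\<close>, with \<open>R\<close> in heavy rows and \<open>S\<close> in heavy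
  columns, so only \<open>card (R \<union> S)\<close> has to be estimated.\<close>

lemma spanning_card_ge:
  assumes A: "spanning a b m n A" and "a \<le> n" "b \<le> m"
  obtains x y :: nat where "b \<le> x" "x \<le> m" "a \<le> y" "y \<le> n"
    "cost a b m n x y \<le> int (card A)"
proof -
  define X where "X = {i. i < m \<and> a \<le> card (A\<inverse> `` {i})}"
  define Y where "Y = {j. j < n \<and> b \<le> card (A `` {j})}"
  define x y where "x = card X" and "y = card Y"
  have sub: "A \<subseteq> {..<n} \<times> {..<m}"
    using A by (auto simp: spanning_def rect_def)
  then have finA: "finite A"
    by (rule finite_subset) simp
  have XY: "X \<subseteq> {..<m}" "Y \<subseteq> {..<n}"
    by (auto simp: X_def Y_def)
  then have fin: "finite X" "finite Y"
    by (auto intro: finite_subset)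
  have x: "x \<le> m" and y: "y \<le> n"
    using card_mono[OF _ XY(1)] card_mono[OF _ XY(2)] by (simp_all add: x_def y_def)
  define B where "B = ({..<n} - Y) \<times> ({..<m} - X)"
  define R where "R = A \<inter> UNIV \<times> X"
  define S where "S = A \<inter> Y \<times> UNIV"
  have finRS: "finite R" "finite S"
    using finA by (simp_all add: R_def S_def)
  have "B \<subseteq> A"
    using A by (auto simp: B_def X_def Y_def spanning_def)
  then have "A = B \<union> (R \<union> S)"
    using sub by (auto simp: B_def R_def S_def)
  moreover have "B \<inter> (R \<union> S) = {}"
    by (auto simp: B_def R_def S_def)
  moreover have "finite B"
    by (simp add: B_def)
  ultimately have "card A = card B + card (R \<union> S)"
    using finRS by (metis card_Un_disjoint finite_Un)
  moreover have "card B = (n - y) * (m - x)"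
    using XY fin by (simp add: B_def card_cartesian_product card_Diff_subset x_def y_def)
  ultimately have cA: "int (card A) = (int m - int x) * (int n - int y) + int (card (R \<union> S))"
    using x y by (simp add: of_nat_diff mult.commute)
  have "a * card X \<le> card (A\<inverse> \<inter> X \<times> UNIV)"
    using finA fin by (intro card_Times_fibres_ge) (auto simp: X_def)
  also have "A\<inverse> \<inter> X \<times> UNIV = R\<inverse>"
    by (auto simp: R_def)
  finally have R: "int a * int x \<le> int (card R)"
    by (simp add: x_def flip: of_nat_mult)
  have "b * card Y \<le> card S"
    unfolding S_def using finA fin by (intro card_Times_fibres_ge) (auto simp: Y_def)
  then have S: "int b * int y \<le> int (card S)"
    by (simp add: y_def flip: of_nat_mult)
  have RS: "card R \<le> card (R \<union> S)" "card S \<le> card (R \<union> S)"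
    using finRS by (auto intro: card_mono)
  have cAX: "(int m - int x) * (int n - int y) + int a * int x \<le> int (card A)"
    using cA R RS by linarith
  have cAY: "(int m - int x) * (int n - int y) + int b * int y \<le> int (card A)"
    using cA S RS by linarith
  consider "b \<le> x" "a \<le> y" | "x < b" "a \<le> y" | "b \<le> x" "y < a" | "x < b" "y < a"
    by linarith
  then show thesis
  proof cases
    case 1
    then show thesis
      using that[of x y] x y cAX cAY by (simp add: cost_def max_def)
  next
    case 2
    \<comment> \<open>With \<open>x\<close> raised to \<open>b\<close>, the maximum is still
      \<open>b * y\<close> because \<open>a \<le> y\<close>, while the product does not
      grow.\<close>
    have "int a * int b \<le> int b * int y"
      using 2 by (simp add: mult.commute mult_left_mono)
    moreover have "(int m - int b) * (int n - int y) \<le> (int m - int x) * (int n - int y)"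
      using 2 y by (intro mult_right_mono) auto
    ultimately show thesis
      using that[of b y] 2 assms y cAY by (simp add: cost_def)
  next
    case 3
    have "int b * int a \<le> int a * int x"
      using 3 by (simp add: mult.commute mult_left_mono)
    moreover have "(int m - int x) * (int n - int a) \<le> (int m - int x) * (int n - int y)"
      using 3 x by (intro mult_left_mono) auto
    ultimately show thesis
      using that[of x a] 3 assms x cAX by (simp add: cost_def)
  next
    case 4
    \<comment> \<open>Inclusion-exclusion: points of \<open>R \<inter> S\<close> lie in a heavy row
      and a heavy column, so there are at most \<open>x * y\<close> of them.\<close>
    have "card R + card S = card (R \<union> S) + card (R \<inter> S)"
      using finRS by (rule card_Un_Int)
    moreover have "card (R \<inter> S) \<le> card (Y \<times> X)"
      using fin by (intro card_mono) (auto simp: R_def S_def)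
    ultimately have "int (card R) + int (card S) \<le> int (card (R \<union> S)) + int x * int y"
      by (simp add: card_cartesian_product x_def y_def mult.commute flip: of_nat_mult of_nat_add)
    then have "(int m - int x) * (int n - int y) + int a * int x + int b * int y - int x * int y
        \<le> int (card A)"
      using cA R S by linarith
    \<comment> \<open>In the bound above the products \<open>x * y\<close> cancel, so it is linear
      in \<open>x\<close> and \<open>y\<close>. These two terms add up to its excess over its value
      at \<open>x = b\<close>, \<open>y = a\<close>.\<close>
    moreover have "0 \<le> (int b - int x) * (int n - int a)" "0 \<le> (int a - int y) * (int m - int b)"
      using 4 assms by simp_all
    ultimately have "(int m - int b) * (int n - int a) + int a * int b \<le> int (card A)"
      by (simp add: algebra_simps)
    then show thesis
      using that[of b a] assms by (simp add: cost_def mult.commute)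
  qed
qed

text \<open>Filling the rows of the \<open>x \<times> y\<close> corner one after the other with \<open>a\<close> consecutive
  cells each, cyclically over the \<open>y\<close> columns, balances the columns.\<close>

lemma spanning_exists_aux:
  assumes "1 \<le> a" "a \<le> y" "y \<le> n" "x \<le> m" "b * y \<le> a * x"
  obtains A where "spanning a b m n A" "card A \<le> (m - x) * (n - y) + a * x"
proof -
  define D where "D = (\<lambda>t. (t mod y, t div a)) ` {..<a * x}"
  define A where "A = D \<union> {y..<n} \<times> {x..<m}"
  have D: "D \<subseteq> {..<y} \<times> {..<x}"
    using assms by (auto simp: D_def less_mult_imp_div_less mult.commute)
  have sub: "A \<subseteq> rect n m"
    using D assms by (auto simp: A_def rect_def)
  have finA: "finite A"
    by (simp add: A_def D_def)
  have row: "a \<le> card (A\<inverse> `` {i})" if "i < x" for i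
  proof -
    \<comment> \<open>Since \<open>a \<le> y\<close>, any \<open>a\<close> consecutive numbers have
      distinct residues modulo \<open>y\<close>, so row \<open>i\<close> receives \<open>a\<close>
      distinct columns.\<close>
    have "inj_on (\<lambda>k. (a * i + k) mod y) {..<a}"
    proof (rule inj_onI, goal_cases)
      case (1 k l)
      then have "[a * i + k = a * i + l] (mod y)"
        by (simp add: cong_def)
      then have "[k = l] (mod y)"
        by (simp add: cong_add_lcancel_nat)
      then show ?case
        using 1 assms by (simp add: cong_def)
    qed
    then have "a = card ((\<lambda>k. (a * i + k) mod y) ` {..<a})"
      by (simp add: card_image)
    also have "\<dots> \<le> card (A\<inverse> `` {i})"
    proof (rule card_mono)
      show "finite (A\<inverse> `` {i})"
        using finA by (simp add: finite_Image)
      have "((a * i + k) mod y, i) \<in> D" if "k < a" for k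
      proof -
        have "a * i + k < a * Suc i"
          using that by simp
        also have "\<dots> \<le> a * x"
          using \<open>i < x\<close> by (intro mult_left_mono) auto
        finally show ?thesis
          using that unfolding D_def by (intro image_eqI[of _ _ "a * i + k"]) auto
      qed
      then show "(\<lambda>k. (a * i + k) mod y) ` {..<a} \<subseteq> A\<inverse> `` {i}"
        by (auto simp: A_def)
    qed
    finally show ?thesis .
  qed
  have col: "b \<le> card (A `` {j})" if "j < y" for j
  proof -
    \<comment> \<open>Consecutive visits to column \<open>j\<close> are \<open>y \<ge> a\<close>
      steps apart and so fall in different rows.\<close>
    have "strict_mono (\<lambda>s. (j + y * s) div a)"
    proof (rule strict_mono_Suc_iff[THEN iffD2], rule allI)
      fix s
      have "(j + y * s) div a < (j + y * s + a) div a"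
        using assms by simp
      also have "\<dots> \<le> (j + y * Suc s) div a"
        using assms by (intro div_le_mono) simp
      finally show "(j + y * s) div a < (j + y * Suc s) div a" .
    qed
    then have "b = card ((\<lambda>s. (j + y * s) div a) ` {..<b})"
      by (simp add: card_image strict_mono_imp_inj_on)
    also have "\<dots> \<le> card (A `` {j})"
    proof (rule card_mono)
      show "finite (A `` {j})"
        using finA by (simp add: finite_Image)
      have "(j, (j + y * s) div a) \<in> D" if "s < b" for s
      proof -
        \<comment> \<open>The hypothesis \<open>b * y \<le> a * x\<close> leaves room for
          \<open>b\<close> visits to each column.\<close>
        have "j + y * s < y * Suc s"
          using \<open>j < y\<close> by simp
        also have "\<dots> \<le> y * b"
          using that by (intro mult_left_mono) auto
        also have "\<dots> \<le> a * x"
          using assms by (simp add: mult.commute)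
        finally show ?thesis
          using \<open>j < y\<close> unfolding D_def by (intro image_eqI[of _ _ "j + y * s"]) auto
      qed
      then show "(\<lambda>s. (j + y * s) div a) ` {..<b} \<subseteq> A `` {j}"
        by (auto simp: A_def)
    qed
    finally show ?thesis .
  qed
  have "i < x \<or> j < y" if "j < n" "i < m" "(j, i) \<notin> A" for i j
    using that by (auto simp: A_def)
  then have "spanning a b m n A"
    using sub row col unfolding spanning_def by blast
  moreover have "card A \<le> (m - x) * (n - y) + a * x"
  proof -
    have "card A \<le> card D + card ({y..<n} \<times> {x..<m})"
      unfolding A_def by (rule card_Un_le)
    also have "card D \<le> a * x"
      unfolding D_def by (rule order_trans[OF card_image_le]) simp_all
    finally show ?thesis
      by (simp add: card_cartesian_product mult.commute)
  qed
  ultimately show thesis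
    by (rule that)
qed

text \<open>If \<open>a * x < b * y\<close>, transposing the grid exchanges the two products and
  brings the situation back to \<open>spanning_exists_aux\<close>.\<close>

lemma spanning_exists:
  assumes "1 \<le> a" "1 \<le> b" "b \<le> x" "x \<le> m" "a \<le> y" "y \<le> n"
  obtains A where "spanning a b m n A" "int (card A) \<le> cost a b m n x y"
proof (cases "b * y \<le> a * x")
  case True
  then obtain A where A: "spanning a b m n A" "card A \<le> (m - x) * (n - y) + a * x"
    using assms spanning_exists_aux by metis
  have "int (card A) \<le> (int m - int x) * (int n - int y) + int a * int x"
    using A(2) assms by (simp flip: of_nat_diff of_nat_mult of_nat_add)
  then show thesis
    using A(1) that by (simp add: cost_def)
next
  case False
  then obtain A where A: "spanning b a n m A" "card A \<le> (n - y) * (m - x) + b * y"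
    using assms spanning_exists_aux[of b x m y n a] by (metis nat_le_linear)
  have "int (card A) \<le> (int n - int y) * (int m - int x) + int b * int y"
    using A(2) assms by (simp flip: of_nat_diff of_nat_mult of_nat_add)
  then have "int (card (A\<inverse>)) \<le> cost a b m n x y"
    by (simp add: cost_def mult.commute)
  then show thesis
    using spanning_converse[OF A(1)] that by blast
qed

section \<open>The two bounds combined\<close>

definition costs :: "int \<Rightarrow> int \<Rightarrow> int \<Rightarrow> int \<Rightarrow> int set" where
  "costs a b m n = {cost a b m n x y | x y. b \<le> x \<and> x \<le> m \<and> a \<le> y \<and> y \<le> n}"

lemma cost_in_costs:
  "b \<le> x \<Longrightarrow> x \<le> m \<Longrightarrow> a \<le> y \<Longrightarrow> y \<le> n \<Longrightarrow> cost a b m n x y \<in> costs a b m n"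
  by (auto simp: costs_def)

lemma finite_costs [simp]: "finite (costs a b m n)"
proof -
  have "costs a b m n \<subseteq> (\<lambda>(x, y). cost a b m n x y) ` ({b..m} \<times> {a..n})"
    by (force simp: costs_def)
  then show ?thesis
    by (rule finite_subset) simp
qed

text \<open>A smallest spanning set yields a member of \<open>costs\<close> that is at most its
  size; every member of \<open>costs\<close> is at least the size of some spanning set. Hence the
  two minima agree.\<close>

lemma gamma_rect:
  assumes "1 \<le> a" "a \<le> n" "1 \<le> b" "b \<le> m"
  shows "int (gamma (rect a b) m n) = Min (costs a b m n)"
proof -
  define S where "S = card ` Collect (spanning a b m n)"
  have "A \<subseteq> rect n m \<and> growth (rect a b) m n A = rect n m \<longleftrightarrow> spanning a b m n A" for A
    by (metis growth_eq_rect_iff spanning_def)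
  then have gS: "gamma (rect a b) m n = Min S"
    by (simp add: gamma_def S_def setcompr_eq_image)
  have "S \<subseteq> card ` Pow (rect n m)"
    by (auto simp: S_def spanning_def)
  then have finS: "finite S"
    by (rule finite_subset) simp
  \<comment> \<open>The choice \<open>x = m\<close>, \<open>y = n\<close> shows that spanning sets
    exist, so the minimum is attained.\<close>
  obtain A0 where "spanning a b m n A0"
    using spanning_exists[of a b m m n n] assms by auto
  then have "S \<noteq> {}"
    by (auto simp: S_def)
  then have "Min S \<in> S"
    using finS by simp
  then obtain A where A: "spanning a b m n A" "card A = Min S"
    by (auto simp: S_def)
  obtain x y :: nat where xy: "b \<le> x" "x \<le> m" "a \<le> y" "y \<le> n" "cost a b m n x y \<le> int (Min S)"
    using spanning_card_ge[OF A(1)] assms A(2) by metis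
  have lower: "int (Min S) \<le> c" if c_in: "c \<in> costs a b m n" for c
  proof -
    obtain x y :: int where c: "c = cost a b m n x y" and "b \<le> x" "x \<le> m" "a \<le> y" "y \<le> n"
      using c_in by (auto simp: costs_def)
    then have "b \<le> nat x" "nat x \<le> m" "a \<le> nat y" "nat y \<le> n" "0 \<le> x" "0 \<le> y"
      by linarith+
    then obtain A where "spanning a b m n A" "int (card A) \<le> c"
      using spanning_exists[of a b "nat x" m "nat y" n] assms c by auto
    moreover have "Min S \<le> card A"
      using \<open>spanning a b m n A\<close> finS by (intro Min_le) (auto simp: S_def)
    ultimately show ?thesis
      by linarith
  qed
  have "cost a b m n x y \<in> costs a b m n"
    using xy by (intro cost_in_costs) auto
  moreover from this have "cost a b m n x y = int (Min S)"
    using lower xy(5) by fastforce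
  ultimately show ?thesis
    unfolding gS using lower by (intro Min_eqI[symmetric]) auto
qed

subsection \<open>The square case\<close>

text \<open>For \<open>a = b\<close>, replacing both \<open>x\<close> and \<open>y\<close> by the
  larger one keeps the maximum and does not increase the product. This leaves a convex quadratic in
  the single variable \<open>z\<close>.\<close>

lemma Min_costs_diagonal:
  assumes "1 \<le> a" and z: "a \<le> z" "z \<le> n" "(n - z)\<^sup>2 + a * z = c"
    and le: "\<And>z. a \<le> z \<Longrightarrow> z \<le> n \<Longrightarrow> c \<le> (n - z)\<^sup>2 + a * z"
  shows "Min (costs a a n n) = c"
proof (rule Min_eqI)
  show "c \<in> costs a a n n"
    using cost_in_costs[of a z n a z n] z by (simp add: cost_def power2_eq_square)
  fix d assume "d \<in> costs a a n n"
  then obtain x y where xy: "d = cost a a n n x y" "a \<le> x" "x \<le> n" "a \<le> y" "y \<le> n"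
    by (auto simp: costs_def)
  have "(n - max x y) * (n - max x y) \<le> (n - x) * (n - y)"
    using xy by (intro mult_mono) auto
  moreover have "max (a * x) (a * y) = a * max x y"
    using \<open>1 \<le> a\<close> by (simp add: max_mult_distrib_left)
  ultimately have "(n - max x y)\<^sup>2 + a * max x y \<le> d"
    by (simp add: xy(1) cost_def power2_eq_square)
  then show "c \<le> d"
    using le[of "max x y"] xy(2-5) by linarith
qed simp

text \<open>The vertex \<open>z = n - k\<close> is an integer, and \<open>3 * k \<le> n\<close> says
  that it is admissible.\<close>

lemma Min_costs_even:
  assumes "1 \<le> k" "3 * k \<le> n"
  shows "Min (costs (2 * k) (2 * k) n n) = 2 * k * n - k\<^sup>2"
proof (rule Min_costs_diagonal[where z = "n - k"])
  fix z :: int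
  have "0 \<le> (n - z - k)\<^sup>2"
    by simp
  then show "2 * k * n - k\<^sup>2 \<le> (n - z)\<^sup>2 + 2 * k * z"
    by (simp add: power2_eq_square algebra_simps)
qed (use assms in \<open>simp_all add: power2_eq_square algebra_simps\<close>)

text \<open>The real vertex \<open>n - k - 1/2\<close> is midway between two integers, of which
  \<open>n - k\<close> is taken. The excess is a product of two consecutive integers, hence
  nonnegative.\<close>

lemma Min_costs_odd:
  assumes "0 \<le> k" "3 * k + 1 \<le> n"
  shows "Min (costs (2 * k + 1) (2 * k + 1) n n) = (2 * k + 1) * n - k * (k + 1)"
proof (rule Min_costs_diagonal[where z = "n - k"])
  fix z :: int
  have "0 \<le> (n - z - k) * (n - z - k - 1)"
    by (auto simp: zero_le_mult_iff)
  then show "(2 * k + 1) * n - k * (k + 1) \<le> (n - z)\<^sup>2 + (2 * k + 1) * z"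
    by (simp add: power2_eq_square algebra_simps)
qed (use assms in \<open>simp_all add: power2_eq_square algebra_simps\<close>)

text \<open>The vertex is at most \<open>a + 1/2\<close>, so the left end \<open>z = a\<close> is
  optimal among integers.\<close>

lemma Min_costs_large:
  assumes "1 \<le> a" "a \<le> n" "2 * n \<le> 3 * a + 1"
  shows "Min (costs a a n n) = a\<^sup>2 + (n - a)\<^sup>2"
proof (rule Min_costs_diagonal[where z = a])
  fix z assume "a \<le> z"
  then have "0 \<le> (z - a) * (z + 2 * a - 2 * n)"
    using assms by (auto simp: zero_le_mult_iff)
  then show "a\<^sup>2 + (n - a)\<^sup>2 \<le> (n - z)\<^sup>2 + a * z"
    by (simp add: power2_eq_square algebra_simps)
qed (use assms in \<open>simp_all add: power2_eq_square\<close>)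

lemma gamma_square:
  assumes "1 \<le> a" "a \<le> n"
  shows "real (gamma (rect a a) n n) =
     (if real a \<le> 2 * real n / 3 \<and> even a
        then real a * real n - (real a)\<^sup>2 / 4
      else if real a \<le> (2 * real n + 1) / 3 \<and> odd a
        then real a * real n - ((real a)\<^sup>2 - 1) / 4
      else (real a)\<^sup>2 + (real n - real a)\<^sup>2)"
proof -
  have \<gamma>: "real (gamma (rect a a) n n) = of_int (Min (costs a a n n))"
    using gamma_rect[of a n a n] assms by simp
  \<comment> \<open>For \<open>a = 2 * k\<close> the condition \<open>a \<le> 2 * n / 3\<close>
    reads \<open>3 * k \<le> n\<close>; for \<open>a = 2 * k + 1\<close> the condition
    \<open>a \<le> (2 * n + 1) / 3\<close> reads \<open>3 * k + 1 \<le> n\<close>.\<close>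
  consider k where "a = 2 * k" "3 * k \<le> n" | k where "a = 2 * k + 1" "3 * k + 1 \<le> n"
    | "even a" "2 * n < 3 * a" | "odd a" "2 * n + 1 < 3 * a"
    by (cases "even a") (fastforce elim!: evenE oddE)+
  then show ?thesis
  proof cases
    case 1
    then show ?thesis
      using \<gamma> Min_costs_even[of k n] assms by (simp add: power2_eq_square)
  next
    case 2
    have "int a = 2 * int k + 1"
      using 2 by simp
    then have "real (gamma (rect a a) n n) = (2 * real k + 1) * real n - real k * (real k + 1)"
      unfolding \<gamma> \<open>int a = 2 * int k + 1\<close> using Min_costs_odd[of k n] 2(2) by simp
    then show ?thesis
      using 2 by (simp add: power2_eq_square field_simps)
  next
    case 3
    then show ?thesis
      using \<gamma> Min_costs_large[of a n] assms by simp
  next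
    case 4
    then show ?thesis
      using \<gamma> Min_costs_large[of a n] assms by simp
  qed
qed

subsection \<open>Reduction to finitely many rays\<close>

lemma int_div_bounds:
  fixes b x :: int
  assumes "0 < b"
  shows "b * (x div b) \<le> x" "x < b * (x div b + 1)"
proof -
  have "b * (x div b) = x - x mod b" "0 \<le> x mod b" "x mod b < b"
    using assms by (simp_all add: minus_mod_eq_mult_div)
  then show "b * (x div b) \<le> x" "x < b * (x div b + 1)"
    by (simp_all add: distrib_left)
qed

lemma int_le_div_iff:
  fixes b c x :: int
  assumes "0 < b"
  shows "c \<le> x div b \<longleftrightarrow> b * c \<le> x"
proof
  assume "c \<le> x div b"
  then have "b * c \<le> b * (x div b)"
    using assms by simp
  then show "b * c \<le> x"
    using int_div_bounds(1)[OF assms, of x] by linarith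
next
  assume "b * c \<le> x"
  then have "b * c < b * (x div b + 1)"
    using int_div_bounds(2)[OF assms, of x] by linarith
  then show "c \<le> x div b"
    using assms by simp
qed

text \<open>The increment from \<open>q\<close> to \<open>q + 1\<close> is
  \<open>A * (2 * q + 1) - B\<close>. The negated floor is a ceiling, namely the least integer at
  which this increment is nonnegative; by convexity, clipping it to \<open>d..h\<close> gives the
  constrained minimum.\<close>

lemma quadratic_le_at_clipped_vertex:
  fixes A B d h q' :: int
  assumes "0 < A" "d \<le> q'" "q' \<le> h"
  defines "q \<equiv> min (max (- ((A - B) div (2 * A))) d) h"
  shows "A * q\<^sup>2 - B * q \<le> A * q'\<^sup>2 - B * q'"
proof -
  define u where "u = (A - B) div (2 * A)"
  have u: "2 * A * u \<le> A - B" "A - B < 2 * A * u + 2 * A"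
    using \<open>0 < A\<close> int_div_bounds[of "2 * A" "A - B"] by (simp_all add: u_def distrib_left)
  have "0 \<le> (q' - q) * (A * (q' + q) - B)"
  proof (cases q q' rule: linorder_cases)
    case less
    then have "1 - 2 * u \<le> q' + q"
      using assms(3) by (simp add: q_def flip: u_def)
    then have "A * (1 - 2 * u) \<le> A * (q' + q)"
      using \<open>0 < A\<close> by simp
    then show ?thesis
      using less u by (intro mult_nonneg_nonneg) (simp_all add: algebra_simps)
  next
    case greater
    then have "q \<le> - u"
      using assms(2) by (simp add: q_def min_def max_def split: if_splits flip: u_def)
    then have "q' + q \<le> - 1 - 2 * u"
      using greater by linarith
    then have "A * (q' + q) \<le> A * (- 1 - 2 * u)"
      using \<open>0 < A\<close> by simp
    then show ?thesis
      using greater u by (intro mult_nonpos_nonpos) (simp_all add: algebra_simps)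
  qed simp
  then show ?thesis
    by (simp add: power2_eq_square algebra_simps)
qed

text \<open>Up to \<open>a * x div b\<close> the cost does not increase with \<open>y\<close>;
  beyond it, the cost is linear with slope \<open>b - (m - x)\<close>. So either a neighbor of the
  diagonal is at least as good, or the cost is at least \<open>b * n\<close>, which is the reason
  for the bound on \<open>W\<close>.\<close>

lemma le_cost_if_le_near_diagonal:
  assumes "0 < b" "b \<le> x" "x \<le> m" "a \<le> y" "y \<le> n" and W: "W \<le> b * n"
    and near: "\<And>y. a * x div b \<le> y \<Longrightarrow> y \<le> a * x div b + 1 \<Longrightarrow> y \<le> n \<Longrightarrow> W \<le> cost a b m n x y"
  shows "W \<le> cost a b m n x y"
proof -
  define f where "f = a * x div b"
  have f: "b * f \<le> a * x" "a * x < b * (f + 1)"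
    unfolding f_def using int_div_bounds[OF \<open>0 < b\<close>] by auto
  show ?thesis
  proof (cases "y \<le> f")
    case True
    then have "b * y \<le> b * f"
      using \<open>0 < b\<close> by simp
    then have y: "cost a b m n x y = (m - x) * (n - y) + a * x"
      using f by (simp add: cost_def)
    show ?thesis
    proof (cases "f \<le> n")
      case True
      have "(m - x) * (n - f) \<le> (m - x) * (n - y)"
        using assms \<open>y \<le> f\<close> by (intro mult_left_mono) auto
      then show ?thesis
        using near[of f] True f y by (simp add: cost_def f_def)
    next
      case False
      then have "b * n \<le> b * f"
        using \<open>0 < b\<close> by simp
      moreover have "0 \<le> (m - x) * (n - y)"
        using assms by simp
      ultimately show ?thesis
        using f W y by linarith
    qed
  next
    case False
    then have "b * (f + 1) \<le> b * y"
      using \<open>0 < b\<close> by simp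
    then have y: "cost a b m n x y = (m - x) * (n - y) + b * y"
      using f by (simp add: cost_def)
    show ?thesis
    proof (cases "m - x \<le> b")
      case True
      have "0 \<le> (b - (m - x)) * (y - (f + 1))"
        using True False by simp
      moreover have "cost a b m n x (f + 1) = (m - x) * (n - (f + 1)) + b * (f + 1)"
        using f by (simp add: cost_def)
      ultimately have "cost a b m n x (f + 1) \<le> cost a b m n x y"
        by (simp add: y algebra_simps)
      moreover have "W \<le> cost a b m n x (f + 1)"
        using near[of "f + 1"] \<open>\<not> y \<le> f\<close> \<open>y \<le> n\<close> by (simp add: f_def)
      ultimately show ?thesis
        by linarith
    next
      case False
      then have "0 \<le> (m - x - b) * (n - y)"
        using assms by simp
      then show ?thesis
        using W y by (simp add: algebra_simps)
    qed
  qed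
qed

text \<open>Along the ray \<open>(k * q + r, a' * q + c)\<close> both arguments of the maximum in \<open>cost\<close> grow
  by \<open>a * k = b * a'\<close> per step, so that \<open>cost\<close> is a quadratic polynomial in \<open>q\<close>.\<close>

lemma cost_ray:
  assumes "a = a' * d" "b = k * d"
  shows "cost a b m n (k * q + r) (a' * q + c) =
    a' * k * q\<^sup>2 - (k * (n - c) + a' * (m - r) - a * k) * q + ((m - r) * (n - c) + max (a * r) (b * c))"
proof -
  have "max (a * (k * q + r)) (b * (a' * q + c)) = a * k * q + max (a * r) (b * c)"
    using assms by (simp add: max_def algebra_simps)
  then show ?thesis
    by (simp add: cost_def power2_eq_square algebra_simps)
qed

subsection \<open>Running time of while-programs\<close>

fun loop_free :: "prog \<Rightarrow> bool" where
  "loop_free (Seq p q) \<longleftrightarrow> loop_free p \<and> loop_free q"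
| "loop_free (Cond g p q) \<longleftrightarrow> loop_free p \<and> loop_free q"
| "loop_free (While g p) \<longleftrightarrow> False"
| "loop_free _ \<longleftrightarrow> True"

text \<open>On loops \<open>exec\<close>, \<open>time_bound\<close> and \<open>writes\<close> are junk.\<close>

fun exec :: "prog \<Rightarrow> state \<Rightarrow> state" where
  "exec (Assign r e) s = s(r := aval e s)"
| "exec (Seq p q) s = exec q (exec p s)"
| "exec (Cond g p q) s = (if bval g s then exec p s else exec q s)"
| "exec _ s = s"

fun time_bound :: "prog \<Rightarrow> nat" where
  "time_bound (Assign r e) = acost e"
| "time_bound (Seq p q) = time_bound p + time_bound q"
| "time_bound (Cond g p q) = bcost g + max (time_bound p) (time_bound q)"
| "time_bound _ = 0"

lemma runs_loop_free:
  "loop_free p \<Longrightarrow> \<exists>t \<le> time_bound p. runs p s t (exec p s)"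
proof (induction p arbitrary: s)
  case (Seq p q)
  obtain t u where "t \<le> time_bound p" "runs p s t (exec p s)"
    "u \<le> time_bound q" "runs q (exec p s) u (exec q (exec p s))"
    using Seq by fastforce
  then show ?case
    using runs.Seq by (intro exI[of _ "t + u"]) auto
next
  case (Cond g p q)
  obtain t u where "t \<le> time_bound p" "runs p s t (exec p s)"
    "u \<le> time_bound q" "runs q s u (exec q s)"
    using Cond by fastforce
  then show ?case
    using runs.CondTrue[of g s p t] runs.CondFalse[of g s q u]
    by (cases "bval g s") (auto intro: exI[of _ "bcost g + t"] exI[of _ "bcost g + u"])
next
  case (Assign r e)
  then show ?case
    using runs.Assign[of r e s] by (auto simp: fun_upd_def)
qed (simp_all add: runs.Skip)

text \<open>There are \<open>N\<close> runs of the body and \<open>N + 1\<close> evaluations of the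
  guard, the last one failing.\<close>

lemma runs_While:
  assumes "loop_free p" and "\<And>i. i < N \<Longrightarrow> bval g ((exec p ^^ i) s)" and "\<not> bval g ((exec p ^^ N) s)"
  shows "\<exists>t \<le> N * (bcost g + time_bound p) + bcost g. runs (While g p) s t ((exec p ^^ N) s)"
  using assms(2,3)
proof (induction N arbitrary: s)
  case 0
  then show ?case
    by (auto intro: WhileFalse)
next
  case (Suc N)
  obtain t where t: "t \<le> time_bound p" "runs p s t (exec p s)"
    using runs_loop_free[OF assms(1)] by blast
  have "\<exists>u \<le> N * (bcost g + time_bound p) + bcost g.
      runs (While g p) (exec p s) u ((exec p ^^ N) (exec p s))"
  proof (rule Suc.IH)
    show "bval g ((exec p ^^ i) (exec p s))" if "i < N" for i
      using Suc.prems(1)[of "Suc i"] that by (simp add: funpow_swap1)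
    show "\<not> bval g ((exec p ^^ N) (exec p s))"
      using Suc.prems(2) by (simp add: funpow_swap1)
  qed
  then obtain u where "u \<le> N * (bcost g + time_bound p) + bcost g"
      "runs (While g p) (exec p s) u ((exec p ^^ N) (exec p s))"
    by blast
  moreover have "bval g s"
    using Suc.prems(1)[of 0] by simp
  ultimately show ?case
    using t by (intro exI[of _ "bcost g + t + u"]) (auto intro: WhileTrue simp: funpow_swap1)
qed

fun writes :: "prog \<Rightarrow> nat set" where
  "writes (Assign r e) = {r}"
| "writes (Seq p q) = writes p \<union> writes q"
| "writes (Cond g p q) = writes p \<union> writes q"
| "writes _ = {}"

lemma exec_unchanged: "i \<notin> writes p \<Longrightarrow> exec p s i = s i"
  by (induction p arbitrary: s) auto

text \<open>Expressions have no minimum or maximum; conditional assignments supply them at the price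
  of one comparison.\<close>

definition lower_to :: "nat \<Rightarrow> nat \<Rightarrow> prog" where
  "lower_to i j = Cond (Lt (Reg j) (Reg i)) (Assign i (Reg j)) Skip"

definition raise_to :: "nat \<Rightarrow> nat \<Rightarrow> prog" where
  "raise_to i j = Cond (Lt (Reg i) (Reg j)) (Assign i (Reg j)) Skip"

lemma loop_free_lower_raise [simp]: "loop_free (lower_to i j)" "loop_free (raise_to i j)"
  by (simp_all add: lower_to_def raise_to_def)

lemma writes_lower_raise [simp]: "writes (lower_to i j) = {i}" "writes (raise_to i j) = {i}"
  by (simp_all add: lower_to_def raise_to_def)

lemma exec_lower_to [simp]: "exec (lower_to i j) s = s(i := min (s i) (s j))"
  by (auto simp: lower_to_def min_def fun_eq_iff)

lemma exec_raise_to [simp]: "exec (raise_to i j) s = s(i := max (s i) (s j))"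
  by (auto simp: raise_to_def max_def fun_eq_iff)

subsection \<open>The search program\<close>

abbreviation block :: "prog list \<Rightarrow> prog" where
  "block ps \<equiv> foldr Seq ps Skip"

text \<open>Registers: 0--3 hold \<open>a, b, m, n\<close>; 4 holds \<open>k = b div gcd a b\<close>, 5 holds
  \<open>a' = a div gcd a b\<close>, 6 holds \<open>d = gcd a b\<close>; 7 holds the residue \<open>r\<close> of \<open>x\<close> modulo \<open>k\<close>,
  8 the least cost found so far and 9 the offset \<open>c\<close> of the ray \<open>(k * q + r, a' * q + c)\<close>.\<close>

definition find_vertex :: prog where
  "find_vertex = block
    [Assign 10 (Div (Sub (Reg 2) (Reg 7)) (Reg 4)),
     Assign 11 (Div (Sub (Reg 3) (Reg 9)) (Reg 5)),
     lower_to 10 11,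
     Assign 11 (Mul (Reg 5) (Reg 4)),
     Assign 12 (Sub (Add (Mul (Reg 4) (Sub (Reg 3) (Reg 9))) (Mul (Reg 5) (Sub (Reg 2) (Reg 7))))
       (Mul (Reg 0) (Reg 4))),
     Assign 11 (Sub (Lit 0) (Div (Sub (Reg 11) (Reg 12)) (Mul (Lit 2) (Reg 11)))),
     raise_to 11 6,
     lower_to 11 10]"

definition eval_cost :: prog where
  "eval_cost = block
    [Assign 12 (Add (Mul (Reg 4) (Reg 11)) (Reg 7)),
     Assign 13 (Add (Mul (Reg 5) (Reg 11)) (Reg 9)),
     Assign 14 (Mul (Reg 0) (Reg 12)),
     Assign 15 (Mul (Reg 1) (Reg 13)),
     raise_to 14 15,
     Assign 14 (Add (Mul (Sub (Reg 2) (Reg 12)) (Sub (Reg 3) (Reg 13))) (Reg 14))]"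

text \<open>If register 10 is below \<open>d\<close>, the ray has no admissible point and the
  computed cost is discarded.\<close>

definition probe_ray :: prog where
  "probe_ray = block
    [find_vertex, eval_cost, Cond (Lt (Reg 10) (Reg 6)) Skip (lower_to 8 14)]"

text \<open>\<open>A\<close> and \<open>B\<close> are the coefficients from \<open>cost_ray\<close>.
  For positive steps, \<open>h\<close> is the last index at which the ray is still within
  \<open>m\<close> and \<open>n\<close>.\<close>

lemma exec_find_vertex:
  fixes s :: state
  defines "A \<equiv> s 5 * s 4" and "B \<equiv> s 4 * (s 3 - s 9) + s 5 * (s 2 - s 7) - s 0 * s 4"
    and "h \<equiv> min ((s 2 - s 7) div s 4) ((s 3 - s 9) div s 5)"
  shows "exec find_vertex s 10 = h"
    and "exec find_vertex s 11 = min (max (- ((A - B) div (2 * A))) (s 6)) h"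
  by (simp_all add: find_vertex_def A_def B_def h_def)

lemma exec_eval_cost:
  "exec eval_cost s 14 = cost (s 0) (s 1) (s 2) (s 3) (s 4 * s 11 + s 7) (s 5 * s 11 + s 9)"
  by (simp add: eval_cost_def cost_def)

lemma loop_free_probe_ray [simp]: "loop_free probe_ray"
  by (simp add: probe_ray_def find_vertex_def eval_cost_def)

lemma exec_find_vertex_unchanged: "i \<notin> {10, 11, 12} \<Longrightarrow> exec find_vertex s i = s i"
  by (rule exec_unchanged) (simp add: find_vertex_def)

lemma exec_eval_cost_unchanged: "i \<notin> {12, 13, 14, 15} \<Longrightarrow> exec eval_cost s i = s i"
  by (rule exec_unchanged) (simp add: eval_cost_def)

lemma exec_probe_ray_unchanged: "i \<notin> {8, 10, 11, 12, 13, 14, 15} \<Longrightarrow> exec probe_ray s i = s i"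
  by (rule exec_unchanged) (auto simp: probe_ray_def find_vertex_def eval_cost_def)

definition params :: "int \<Rightarrow> int \<Rightarrow> int \<Rightarrow> int \<Rightarrow> int \<Rightarrow> int \<Rightarrow> int \<Rightarrow> state \<Rightarrow> bool" where
  "params a b m n k a' d s \<longleftrightarrow> s 0 = a \<and> s 1 = b \<and> s 2 = m \<and> s 3 = n \<and> s 4 = k \<and> s 5 = a' \<and> s 6 = d"

lemma params_upd [simp]: "6 < i \<Longrightarrow> params a b m n k a' d (s(i := v)) = params a b m n k a' d s"
  by (simp add: params_def)

lemma params_exec_probe_ray [simp]:
  "params a b m n k a' d (exec probe_ray s) = params a b m n k a' d s"
  by (simp add: params_def exec_probe_ray_unchanged)

text \<open>Since \<open>k * d = b\<close> and \<open>a' * d = a\<close>, the bound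
  \<open>q \<ge> d\<close> gives \<open>x \<ge> b\<close> and \<open>y \<ge> a\<close>, so that the
  clipped vertex is admissible; it minimizes the quadratic of \<open>cost_ray\<close>.\<close>

lemma exec_probe_ray:
  assumes "params a b m n k a' d s" "s 7 = r" "s 9 = c"
    and pos: "0 < k" "0 < a'" "0 \<le> r" "0 \<le> c" and a: "a = a' * d" and b: "b = k * d"
  shows "exec probe_ray s 8 \<le> s 8"
    and "exec probe_ray s 8 \<in> insert (s 8) (costs a b m n)"
    and "\<And>q. d \<le> q \<Longrightarrow> k * q + r \<le> m \<Longrightarrow> a' * q + c \<le> n \<Longrightarrow>
           exec probe_ray s 8 \<le> cost a b m n (k * q + r) (a' * q + c)"
proof -
  define h where "h = min ((m - r) div k) ((n - c) div a')"
  define A where "A = a' * k"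
  define B where "B = k * (n - c) + a' * (m - r) - a * k"
  define q where "q = min (max (- ((A - B) div (2 * A))) d) h"
  have res: "exec probe_ray s 8 =
      (if h < d then s 8 else min (s 8) (cost a b m n (k * q + r) (a' * q + c)))"
    using assms(1-3) unfolding h_def A_def B_def q_def
    by (simp add: probe_ray_def params_def exec_find_vertex exec_eval_cost
      exec_find_vertex_unchanged exec_eval_cost_unchanged)
  then show "exec probe_ray s 8 \<le> s 8"
    by simp
  have le_h: "p \<le> h \<longleftrightarrow> k * p + r \<le> m \<and> a' * p + c \<le> n" for p
    using pos by (auto simp: h_def int_le_div_iff)
  have "cost a b m n (k * q + r) (a' * q + c) \<in> costs a b m n" if "d \<le> h"
  proof -
    have "d \<le> q" "q \<le> h"
      using that by (simp_all add: q_def)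
    then have "k * d \<le> k * q" "a' * d \<le> a' * q" "k * q + r \<le> m" "a' * q + c \<le> n"
      using pos le_h by simp_all
    then show ?thesis
      using a b pos by (intro cost_in_costs) linarith+
  qed
  then show "exec probe_ray s 8 \<in> insert (s 8) (costs a b m n)"
    by (simp add: res min_def)
  fix p assume p: "d \<le> p" "k * p + r \<le> m" "a' * p + c \<le> n"
  then have "p \<le> h"
    by (simp add: le_h)
  then have "A * q\<^sup>2 - B * q \<le> A * p\<^sup>2 - B * p"
    unfolding q_def using p pos by (intro quadratic_le_at_clipped_vertex) (simp_all add: A_def)
  then have "cost a b m n (k * q + r) (a' * q + c) \<le> cost a b m n (k * p + r) (a' * p + c)"
    unfolding cost_ray[OF a b] A_def B_def by linarith
  then show "exec probe_ray s 8 \<le> cost a b m n (k * p + r) (a' * p + c)"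
    using p \<open>p \<le> h\<close> by (simp add: res)
qed

section \<open>Probing one residue class\<close>

definition probe_residue :: prog where
  "probe_residue = block
    [Assign 9 (Div (Mul (Reg 0) (Reg 7)) (Reg 1)), probe_ray,
     Assign 9 (Add (Reg 9) (Lit 1)), probe_ray,
     Assign 7 (Add (Reg 7) (Lit 1))]"

text \<open>Invariant of the main loop. Membership in \<open>costs\<close> keeps \<open>W\<close>
  from dropping below the minimum, and \<open>W \<le> b * n\<close> is what
  \<open>le_cost_if_le_near_diagonal\<close> asks for.\<close>

definition best_upto :: "int \<Rightarrow> int \<Rightarrow> int \<Rightarrow> int \<Rightarrow> int \<Rightarrow> int \<Rightarrow> int \<Rightarrow> bool" where
  "best_upto a b m n k r W \<longleftrightarrow> W \<in> costs a b m n \<and> W \<le> b * n \<and>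
     (\<forall>x y. b \<le> x \<longrightarrow> x \<le> m \<longrightarrow> y \<le> n \<longrightarrow> x mod k < r \<longrightarrow>
        a * x div b \<le> y \<longrightarrow> y \<le> a * x div b + 1 \<longrightarrow> W \<le> cost a b m n x y)"

lemma exec_probe_residue:
  assumes s: "params a b m n k a' d s" "s 7 = r" "best_upto a b m n k r (s 8)"
    and pos: "0 < k" "0 < a'" "0 < d" "0 \<le> r" and a: "a = a' * d" and b: "b = k * d"
  shows "params a b m n k a' d (exec probe_residue s)" "exec probe_residue s 7 = r + 1"
    and "best_upto a b m n k (r + 1) (exec probe_residue s 8)"
proof -
  show "params a b m n k a' d (exec probe_residue s)" "exec probe_residue s 7 = r + 1"
    using s by (simp_all add: probe_residue_def exec_probe_ray_unchanged)
  have ab: "0 < a" "0 < b"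
    using pos a b by simp_all
  define c where "c = a * r div b"
  define s1 where "s1 = s(9 := c)"
  define s2 where "s2 = (exec probe_ray s1)(9 := c + 1)"
  have W: "exec probe_residue s 8 = exec probe_ray s2 8"
    using s by (simp add: probe_residue_def s1_def s2_def c_def params_def exec_probe_ray_unchanged)
  have c: "0 \<le> c"
    using ab pos by (simp add: c_def pos_imp_zdiv_nonneg_iff)
  have s1: "params a b m n k a' d s1" "s1 7 = r" "s1 9 = c"
    using s by (simp_all add: s1_def)
  have s2: "params a b m n k a' d s2" "s2 7 = r" "s2 9 = c + 1"
    using s1 by (simp_all add: s2_def exec_probe_ray_unchanged)
  note p1 = exec_probe_ray[OF s1 pos(1,2,4) c a b]
  note p2 = exec_probe_ray[OF s2 pos(1,2,4) _ a b]
  have s12: "s1 8 = s 8" "s2 8 = exec probe_ray s1 8"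
    by (simp_all add: s1_def s2_def)
  have le: "exec probe_ray s2 8 \<le> exec probe_ray s1 8" "exec probe_ray s1 8 \<le> s 8"
    using p1(1) p2(1) c by (simp_all add: s12)
  show "best_upto a b m n k (r + 1) (exec probe_residue s 8)"
    unfolding best_upto_def W
  proof (intro conjI allI impI)
    show "exec probe_ray s2 8 \<in> costs a b m n"
      using p1(2) p2(2) c s(3) by (auto simp: s12 best_upto_def)
    show "exec probe_ray s2 8 \<le> b * n"
      using le s(3) by (simp add: best_upto_def)
    fix x y assume xy: "b \<le> x" "x \<le> m" "y \<le> n" "x mod k < r + 1"
      "a * x div b \<le> y" "y \<le> a * x div b + 1"
    show "exec probe_ray s2 8 \<le> cost a b m n x y"
    proof (cases "x mod k < r")
      case True
      then show ?thesis
        using xy s(3) le unfolding best_upto_def by fastforce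
    next
      case False
      define q where "q = x div k"
      have x: "x = k * q + r"
        using False xy(4) mult_div_mod_eq[of k x] by (simp add: q_def)
      \<comment> \<open>As \<open>a * k = b * a'\<close>, moving \<open>x\<close> by
        \<open>k * q\<close> shifts \<open>a * x div b\<close> by exactly \<open>a' * q\<close>.
        Hence both neighbors of the diagonal stay on the two probed rays.\<close>
      have "a * x = a * r + b * (a' * q)"
        by (simp add: x a b algebra_simps)
      then have f: "a * x div b = a' * q + c"
        using ab by (simp add: c_def)
      have "d \<le> q"
        using xy(1) pos by (simp add: q_def b int_le_div_iff)
      consider "y = a' * q + c" | "y = a' * q + (c + 1)"
        using xy f by linarith
      then show ?thesis
      proof cases
        case 1
        then show ?thesis
          using p1(3)[of q] \<open>d \<le> q\<close> xy x le by simp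
      next
        case 2
        then show ?thesis
          using p2(3)[of q] \<open>d \<le> q\<close> xy x c by simp
      qed
    qed
  qed
qed

section \<open>Finding the period, and the complete search\<close>

definition not_period :: bexp where
  "not_period = Neg (Eql (Mul (Div (Mul (Reg 0) (Reg 4)) (Reg 1)) (Reg 1)) (Mul (Reg 0) (Reg 4)))"

definition incr_period :: prog where
  "incr_period = Assign 4 (Add (Reg 4) (Lit 1))"

text \<open>With \<open>k = b div gcd a b\<close>, the two quotients are
  \<open>a div gcd a b\<close> and \<open>gcd a b\<close>. The search starts from
  \<open>b * n\<close>, the cost at \<open>x = b\<close>, \<open>y = n\<close>.\<close>

definition setup_search :: prog where
  "setup_search = block
    [Assign 5 (Div (Mul (Reg 0) (Reg 4)) (Reg 1)), Assign 6 (Div (Reg 1) (Reg 4)),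
     Assign 7 (Lit 0), Assign 8 (Mul (Reg 1) (Reg 3))]"

definition search :: prog where
  "search = Seq (Assign 4 (Lit 1)) (Seq (While not_period incr_period) (Seq setup_search
     (Seq (While (Lt (Reg 7) (Reg 4)) probe_residue) (Assign 0 (Reg 8)))))"

text \<open>The second \<open>bcost not_period\<close> and the final \<open>1\<close> pay for the
  failing guards. They and the setup occur only once but may be charged \<open>k \<ge> 1\<close>
  times.\<close>

definition search_time :: nat where
  "search_time = bcost not_period + time_bound incr_period + bcost not_period
     + time_bound setup_search + (1 + time_bound probe_residue + 1)"

lemma runs_search:
  fixes a b m n :: nat
  assumes ab: "1 \<le> a" "a \<le> n" "1 \<le> b" "b \<le> m"
    and s: "s 0 = int a" "s 1 = int b" "s 2 = int m" "s 3 = int n"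
  shows "\<exists>t s'. runs search s t s' \<and> s' 0 = Min (costs a b m n) \<and> t \<le> search_time * (b div gcd a b)"
proof -
  define d where "d = gcd a b"
  define k where "k = b div d"
  define a' where "a' = a div d"
  have d: "0 < d" and a: "a = a' * d" and b: "b = k * d"
    using ab by (simp_all add: d_def k_def a'_def)
  have k: "0 < k" and a': "0 < a'"
    using a b ab by (auto intro: gr0I)
  have "coprime a' k"
    unfolding a'_def k_def d_def using ab by (intro div_gcd_coprime) auto
  then have period: "b dvd a * j \<longleftrightarrow> k dvd j" for j
    using d by (simp add: a b mult.assoc mult.left_commute[of _ d] mult.commute[of _ d]
      coprime_dvd_mult_right_iff coprime_commute)
  have int_ab: "int a = int a' * int d" "int b = int k * int d"
    by (simp_all flip: of_nat_mult add: a b)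

  define s1 where "s1 = s(4 := 1)"
  have "exec incr_period s = s(4 := s 4 + 1)" for s
    by (simp add: incr_period_def)
  then have s1: "(exec incr_period ^^ i) s1 = s(4 := 1 + int i)" for i
    by (induction i) (simp_all add: s1_def)
  \<comment> \<open>Without a remainder operation, divisibility is tested by dividing and
    multiplying back.\<close>
  have guard: "bval not_period (s(4 := int j)) \<longleftrightarrow> \<not> k dvd j" for j
  proof -
    have "bval not_period (s(4 := int j)) \<longleftrightarrow> \<not> int b dvd int a * int j"
      using s by (simp add: not_period_def) (metis dvd_div_mult_self dvd_triv_right)
    also have "\<dots> \<longleftrightarrow> \<not> k dvd j"
      by (simp add: period flip: of_nat_mult)
    finally show ?thesis .
  qed
  define s2 where "s2 = s(4 := int k)"
  \<comment> \<open>Register 4 starts at 1, so it reaches \<open>k\<close> after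
    \<open>k - 1\<close> increments.\<close>
  have "\<exists>t \<le> (k - 1) * (bcost not_period + time_bound incr_period) + bcost not_period.
      runs (While not_period incr_period) s1 t ((exec incr_period ^^ (k - 1)) s1)"
  proof (rule runs_While)
    show "loop_free incr_period"
      by (simp add: incr_period_def)
    show "bval not_period ((exec incr_period ^^ i) s1)" if "i < k - 1" for i
      using guard[of "Suc i"] that by (auto simp: s1 dest: dvd_imp_le)
    show "\<not> bval not_period ((exec incr_period ^^ (k - 1)) s1)"
      using guard[of k] k by (simp add: s1 of_nat_diff)
  qed
  then obtain t1 where t1: "t1 \<le> (k - 1) * (bcost not_period + time_bound incr_period) + bcost not_period"
      "runs (While not_period incr_period) s1 t1 s2"
    using k by (auto simp: s1 s2_def of_nat_diff)

  define s3 where "s3 = exec setup_search s2"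
  have "loop_free setup_search"
    by (simp add: setup_search_def)
  then obtain t2 where t2: "t2 \<le> time_bound setup_search" "runs setup_search s2 t2 s3"
    using runs_loop_free s3_def by blast
  have "int a * int k div int b = int a'" "int b div int k = int d"
    using k d by (simp_all add: int_ab)
  then have s3: "params a b m n k a' d s3" "s3 7 = 0" "s3 8 = int b * int n"
    using s by (simp_all add: s3_def setup_search_def s2_def params_def)
  have inv: "params a b m n k a' d ((exec probe_residue ^^ i) s3) \<and>
      (exec probe_residue ^^ i) s3 7 = int i \<and>
      best_upto a b m n k i ((exec probe_residue ^^ i) s3 8)" for i
  proof (induction i)
    case 0
    have "int b * int n = cost a b m n b n"
      using ab by (simp add: cost_def max_def mult.commute)
    then have "int b * int n \<in> costs a b m n"
      using ab cost_in_costs[of b b m a n n] by simp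
    moreover have "\<not> x mod int k < 0" for x
      using k by (simp add: not_less)
    ultimately show ?case
      using s3 by (simp add: best_upto_def)
  next
    case (Suc i)
    then show ?case
      using exec_probe_residue[of a b m n k a' d "(exec probe_residue ^^ i) s3" i] k a' d int_ab
      by (simp add: add.commute)
  qed
  define s4 where "s4 = (exec probe_residue ^^ k) s3"
  have "\<exists>t \<le> k * (bcost (Lt (Reg 7) (Reg 4)) + time_bound probe_residue) + bcost (Lt (Reg 7) (Reg 4)).
      runs (While (Lt (Reg 7) (Reg 4)) probe_residue) s3 t s4"
    unfolding s4_def
  proof (rule runs_While)
    show "loop_free probe_residue"
      by (simp add: probe_residue_def)
  qed (use inv in \<open>auto simp: params_def\<close>)
  then obtain t3 where t3: "t3 \<le> k * (1 + time_bound probe_residue) + 1"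
      "runs (While (Lt (Reg 7) (Reg 4)) probe_residue) s3 t3 s4"
    by auto

  have best: "best_upto a b m n k k (s4 8)"
    using inv[of k] by (simp add: s4_def)
  have "s4 8 = Min (costs a b m n)"
  proof (rule Min_eqI[symmetric])
    show "s4 8 \<in> costs a b m n"
      using best by (simp add: best_upto_def)
    fix v assume "v \<in> costs a b m n"
    then obtain x y where v: "v = cost a b m n x y"
        and xy: "int b \<le> x" "x \<le> int m" "int a \<le> y" "y \<le> int n"
      by (auto simp: costs_def)
    \<comment> \<open>After \<open>k\<close> passes every residue has been treated.\<close>
    have "x mod int k < int k"
      using k by simp
    then have near: "s4 8 \<le> cost a b m n x z"
      if "int a * x div int b \<le> z" "z \<le> int a * x div int b + 1" "z \<le> int n" for z
      using best that xy unfolding best_upto_def by blast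
    have "0 < int b" "s4 8 \<le> int b * int n"
      using best ab by (simp_all add: best_upto_def)
    then show "s4 8 \<le> v"
      unfolding v by (rule le_cost_if_le_near_diagonal[OF _ xy _ near])
  qed simp
  moreover have "runs search s (0 + (t1 + (t2 + (t3 + 0)))) (s4(0 := s4 8))"
  proof -
    have "runs (Assign 4 (Lit 1)) s 0 s1"
      using runs.Assign[of 4 "Lit 1" s] by (simp add: s1_def)
    moreover have "runs (Assign 0 (Reg 8)) s4 0 (s4(0 := s4 8))"
      using runs.Assign[of 0 "Reg 8" s4] by simp
    ultimately show ?thesis
      unfolding search_def by (intro runs.Seq[OF _ runs.Seq[OF t1(2) runs.Seq[OF t2(2) runs.Seq[OF t3(2)]]]])
  qed
  moreover have "0 + (t1 + (t2 + (t3 + 0))) \<le> search_time * k"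
  proof -
    have le: "u \<le> k * u" for u
      using k by simp
    have "t1 \<le> k * (bcost not_period + time_bound incr_period) + k * bcost not_period"
      by (rule order_trans[OF t1(1) add_mono[OF mult_le_mono1 le]]) simp
    moreover have "t2 \<le> k * time_bound setup_search"
      by (rule order_trans[OF t2(1) le])
    moreover have "t3 \<le> k * (1 + time_bound probe_residue) + k * 1"
      by (rule order_trans[OF t3(1) add_left_mono[OF le]])
    ultimately show ?thesis
      unfolding search_time_def by (simp add: algebra_simps)
  qed
  ultimately show ?thesis
    unfolding d_def[symmetric] k_def[symmetric]
    by (intro exI[of _ "0 + (t1 + (t2 + (t3 + 0)))"] exI[of _ "s4(0 := s4 8)"]) simp
qed

section \<open>Reduction to the smaller parameter as divisor\<close>

definition swap_params :: prog where
  "swap_params = Cond (Lt (Reg 0) (Reg 1))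
    (block [Assign 4 (Reg 0), Assign 0 (Reg 1), Assign 1 (Reg 4),
            Assign 4 (Reg 2), Assign 2 (Reg 3), Assign 3 (Reg 4)]) Skip"

lemma costs_swap: "costs b a n m = costs a b m n"
  unfolding costs_def cost_swap[of b a n m] by blast

text \<open>Transposing the grid exchanges \<open>(a, n)\<close> with \<open>(b, m)\<close> and
  preserves the costs. After it register 1 holds \<open>min a b\<close>, which governs the time of
  \<open>search\<close>.\<close>

lemma runs_swap_search:
  fixes a b m n :: nat
  assumes ab: "1 \<le> a" "a \<le> n" "1 \<le> b" "b \<le> m"
  shows "\<exists>t s. runs (Seq swap_params search) (init_state a b m n) t s \<and>
    out_val s = Min (costs a b m n) \<and>
    real t \<le> real (search_time + 1) * (real (min a b) / real (gcd a b))"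
proof -
  let ?s = "exec swap_params (init_state a b m n)"
  have "loop_free swap_params" "time_bound swap_params = 1"
    by (simp_all add: swap_params_def)
  then obtain t0 where t0: "t0 \<le> 1" "runs swap_params (init_state a b m n) t0 ?s"
    using runs_loop_free by metis
  have "\<exists>t s. runs search ?s t s \<and> s 0 = Min (costs a b m n) \<and> t \<le> search_time * (min a b div gcd a b)"
  proof (cases "a < b")
    case True
    then show ?thesis
      using runs_search[of b m a n ?s] ab
      by (simp add: swap_params_def init_state_def costs_swap gcd.commute min_def)
  next
    case False
    then show ?thesis
      using runs_search[of a n b m ?s] ab
      by (simp add: swap_params_def init_state_def)
  qed
  then obtain t s where t: "runs search ?s t s" "s 0 = Min (costs a b m n)"
      "t \<le> search_time * (min a b div gcd a b)"
    by blast
  have "gcd a b dvd min a b"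
    by (simp add: min_def)
  moreover from this have "gcd a b \<le> min a b"
    using ab by (intro dvd_imp_le) auto
  \<comment> \<open>The one comparison of the swap is covered because
    \<open>min a b div gcd a b\<close> is at least 1.\<close>
  ultimately have "t0 \<le> min a b div gcd a b"
    using t0(1) ab by (auto simp: Suc_le_eq div_greater_zero_iff intro: order_trans)
  then have "t0 + t \<le> (search_time + 1) * (min a b div gcd a b)"
    using t(3) by simp
  then have "real (t0 + t) \<le> real (search_time + 1) * real (min a b div gcd a b)"
    by (simp only: of_nat_le_iff flip: of_nat_mult)
  also have "real (min a b div gcd a b) = real (min a b) / real (gcd a b)"
    using \<open>gcd a b dvd min a b\<close> by (rule real_of_nat_div)
  finally have "real (t0 + t) \<le> real (search_time + 1) * (real (min a b) / real (gcd a b))" .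
  then show ?thesis
    using runs.Seq[OF t0(2) t(1)] t(2) unfolding out_val_def by blast
qed

theorem theorem1p2:
  shows "(\<forall>a b m n :: nat. 1 \<le> a \<and> a \<le> n \<and> 1 \<le> b \<and> b \<le> m \<longrightarrow>
           int (gamma (rect a b) m n) =
             Min {(int m - x) * (int n - y) + max (int a * x) (int b * y) | x y :: int.
                    int b \<le> x \<and> x \<le> int m \<and> int a \<le> y \<and> y \<le> int n})
       \<and> (\<exists>(p :: prog) (C :: real). \<forall>a b m n :: nat.
           1 \<le> a \<and> a \<le> n \<and> 1 \<le> b \<and> b \<le> m \<longrightarrow>
           (\<exists>t s. runs p (init_state a b m n) t s
                \<and> out_val s = int (gamma (rect a b) m n)
                \<and> real t \<le> C * (real (min a b) / real (gcd a b))))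
       \<and> (\<forall>a n :: nat. 1 \<le> a \<and> a \<le> n \<longrightarrow>
           real (gamma (rect a a) n n) =
             (if real a \<le> 2 * real n / 3 \<and> even a
                then real a * real n - (real a)\<^sup>2 / 4
              else if real a \<le> (2 * real n + 1) / 3 \<and> odd a
                then real a * real n - ((real a)\<^sup>2 - 1) / 4
              else (real a)\<^sup>2 + (real n - real a)\<^sup>2))"
proof (intro conjI allI impI)
  fix a b m n :: nat
  assume "1 \<le> a \<and> a \<le> n \<and> 1 \<le> b \<and> b \<le> m"
  then show "int (gamma (rect a b) m n) =
      Min {(int m - x) * (int n - y) + max (int a * x) (int b * y) | x y :: int.
             int b \<le> x \<and> x \<le> int m \<and> int a \<le> y \<and> y \<le> int n}"
    using gamma_rect[of a n b m] by (simp add: costs_def cost_def)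
next
  show "\<exists>(p :: prog) (C :: real). \<forall>a b m n :: nat.
      1 \<le> a \<and> a \<le> n \<and> 1 \<le> b \<and> b \<le> m \<longrightarrow>
      (\<exists>t s. runs p (init_state a b m n) t s
           \<and> out_val s = int (gamma (rect a b) m n)
           \<and> real t \<le> C * (real (min a b) / real (gcd a b)))"
    using runs_swap_search gamma_rect
    by (intro exI[of _ "Seq swap_params search"] exI[of _ "real (search_time + 1)"]) presburger
qed (use gamma_square in blast)

end
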